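(* Let $N\ge 1$ be an integer and let $f(\delta_\alpha,\delta_\beta)$ be the ULA near-field correlation function defined in the context. Then, for all $\delta_\alpha,\delta_\beta$, $$f(\delta_\alpha,\delta_\beta)=f(\delta_\alpha,-\delta_\beta)=f(-\delta_\alpha,\delta_\beta)=f(-\delta_\alpha,-\delta_\beta).$$ That is, the correlation between a codeword and the channel vectors is symmetric about the codeword in the $\alpha$ and $\beta$ domains.
   Context: Setting: a uniform linear array (ULA) of $N$ antennas with wavelength $\lambda>0$, spacing $d=\lambda/2$, and antenna coordinates $y_n=\left(n-\frac{N+1}{2}\right)d$, $n=1,\dots,N$. For a user at distance $r$ and angle $\theta$ from the array center, the transform-domain coordinates are $\alpha=\frac{\lambda\cos^2\theta}{4r}$ and $\beta=\sin\theta$. Using the second-order (Fresnel) expression for the distances to the antennas, the normalized near-field channel vector $\mathbf{b}(\alpha,\beta)\in\mathbb{C}^N$ has $n$-th entry $\frac{1}{\sqrt N}\exp\left(-j\frac{2\pi}{\lambda}\left(-\beta y_n+\frac{2}{\lambda}\alpha y_n^2\right)\right)$, $j=\sqrt{-1}$. The correlation between the codeword $\mathbf{w}_s=\mathbf{b}^*(\alpha_s,\beta_s)$ (entrywise complex conjugate) and the channel vector $\mathbf{b}(\alpha_q,\beta_q)$ is $|\mathbf{b}(\alpha_q,\beta_q)^T\mathbf{b}^*(\alpha_s,\beta_s)|$; it is expressed through the position differences $\delta_\alpha=\alpha_q-\alpha_s$ and $\delta_\beta=\beta_q-\beta_s$ (real numbers) as $$f(\delta_\alpha,\delta_\beta)=\frac1N\left|\sum_{n=1}^{N}\exp\left(-j\pi\left(-\delta_\alpha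 n^2+\left(\delta_\beta+\delta_\alpha(N+1)\right)n\right)\right)\right|=\frac{1}{N}\left|\sum_{n=1}^{N}\exp\left(-j\frac{2\pi}{\lambda}\left(\delta_\beta y_n-\frac{2}{\lambda}\delta_\alpha y_n^2\right)\right)\right|.$$ *)

theory Defs
  imports "HOL-Analysis.Analysis"
begin

(* Vectors of C^N are functions on nat, used only at the antenna indices 1..N.
   The transform-domain coordinates (alpha, beta) range over all reals, as do
   their differences. *)

definition antenna_spacing :: "real \<Rightarrow> real" where
  "antenna_spacing lam = lam / 2"

definition antenna_pos :: "nat \<Rightarrow> real \<Rightarrow> nat \<Rightarrow> real" where
  "antenna_pos N lam n = (real n - (real N + 1) / 2) * antenna_spacing lam"

definition channel_vec :: "nat \<Rightarrow> real \<Rightarrow> real \<Rightarrow> real \<Rightarrow> nat \<Rightarrow> complex" where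
  "channel_vec N lam \<alpha> \<beta> n =
     complex_of_real (1 / sqrt (real N)) *
     exp (- \<i> * complex_of_real (2 * pi / lam *
       (- \<beta> * antenna_pos N lam n + 2 / lam * \<alpha> * (antenna_pos N lam n)\<^sup>2)))"

definition codeword :: "nat \<Rightarrow> real \<Rightarrow> real \<Rightarrow> real \<Rightarrow> nat \<Rightarrow> complex" where
  "codeword N lam \<alpha> \<beta> n = cnj (channel_vec N lam \<alpha> \<beta> n)"

(* Correlation of the channel vector at (\<alpha>q, \<beta>q) with the codeword at (\<alpha>s, \<beta>s);
   the product is the bilinear one, the conjugation being part of the codeword. *)
definition correlation :: "nat \<Rightarrow> real \<Rightarrow> real \<times> real \<Rightarrow> real \<times> real \<Rightarrow> real" where
  "correlation N lam q s =
     cmod (\<Sum>n=1..N. channel_vec N lam (fst q) (snd q) n * codeword N lam (fst s) (snd s) n)"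

definition ula_f :: "nat \<Rightarrow> real \<Rightarrow> real \<Rightarrow> real" where
  "ula_f N \<delta>\<^sub>\<alpha> \<delta>\<^sub>\<beta> =
     1 / real N * cmod (\<Sum>n=1..N. exp (- \<i> * complex_of_real
       (pi * (- \<delta>\<^sub>\<alpha> * (real n)\<^sup>2 + (\<delta>\<^sub>\<beta> + \<delta>\<^sub>\<alpha> * (real N + 1)) * real n))))"

lemma cmod_sum_phase_shift:
  fixes x y :: "nat \<Rightarrow> real"
  assumes "\<And>n. n \<in> A \<Longrightarrow> x n = c + y n"
  shows "cmod (\<Sum>n\<in>A. exp (- \<i> * complex_of_real (x n))) =
         cmod (\<Sum>n\<in>A. exp (- \<i> * complex_of_real (y n)))"
proof -
  have "(\<Sum>n\<in>A. exp (- \<i> * complex_of_real (x n))) =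
        exp (- \<i> * complex_of_real c) * (\<Sum>n\<in>A. exp (- \<i> * complex_of_real (y n)))"
    unfolding sum_distrib_left
    by (rule sum.cong) (auto simp: assms exp_add [symmetric] algebra_simps)
  then show ?thesis
    by (simp add: norm_mult)
qed

lemma ula_f_eq_positions:
  assumes "lam > 0"
  shows "ula_f N \<delta>\<^sub>\<alpha> \<delta>\<^sub>\<beta> =
     1 / real N * cmod (\<Sum>n=1..N. exp (- \<i> * complex_of_real (2 * pi / lam *
       (\<delta>\<^sub>\<beta> * antenna_pos N lam n - 2 / lam * \<delta>\<^sub>\<alpha> * (antenna_pos N lam n)\<^sup>2))))"
proof -
  define m where "m = (real N + 1) / 2"
  have *: "pi * (- \<delta>\<^sub>\<alpha> * (real n)\<^sup>2 + (\<delta>\<^sub>\<beta> + \<delta>\<^sub>\<alpha> * (real N + 1)) * real n) =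
      pi * (\<delta>\<^sub>\<beta> * m + \<delta>\<^sub>\<alpha> * m\<^sup>2) + 2 * pi / lam *
       (\<delta>\<^sub>\<beta> * antenna_pos N lam n - 2 / lam * \<delta>\<^sub>\<alpha> * (antenna_pos N lam n)\<^sup>2)" for n
  proof -
    have N: "real N + 1 = 2 * m"
      by (simp add: m_def)
    have pos: "antenna_pos N lam n = (real n - m) * (lam / 2)"
      by (simp add: antenna_pos_def antenna_spacing_def m_def)
    show ?thesis
      unfolding N pos using assms by (simp add: field_simps power2_eq_square)
  qed
  show ?thesis
    unfolding ula_f_def by (subst cmod_sum_phase_shift [OF *]) (rule refl)
qed

lemma correlation_eq_ula_f:
  assumes "lam > 0"
  shows "correlation N lam (\<alpha>q, \<beta>q) (\<alpha>s, \<beta>s) = ula_f N (\<alpha>q - \<alpha>s) (\<beta>q - \<beta>s)"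
proof -
  let ?ph = "\<lambda>n. 2 * pi / lam * ((\<beta>q - \<beta>s) * antenna_pos N lam n
      - 2 / lam * (\<alpha>q - \<alpha>s) * (antenna_pos N lam n)\<^sup>2)"
  have sq: "complex_of_real (1 / sqrt (real N)) * complex_of_real (1 / sqrt (real N)) =
      complex_of_real (1 / real N)"
    by (simp flip: of_real_mult)
  have "channel_vec N lam \<alpha>q \<beta>q n * codeword N lam \<alpha>s \<beta>s n =
      complex_of_real (1 / real N) * cnj (exp (- \<i> * complex_of_real (?ph n)))" for n
  proof -
    define a where "a = 2 * pi / lam * (- \<beta>q * antenna_pos N lam n + 2 / lam * \<alpha>q * (antenna_pos N lam n)\<^sup>2)"
    define b where "b = 2 * pi / lam * (- \<beta>s * antenna_pos N lam n + 2 / lam * \<alpha>s * (antenna_pos N lam n)\<^sup>2)"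
    have ph: "?ph n = b - a"
      by (simp add: a_def b_def algebra_simps diff_divide_distrib)
    have "channel_vec N lam \<alpha>q \<beta>q n * codeword N lam \<alpha>s \<beta>s n =
        (complex_of_real (1 / sqrt (real N)) * complex_of_real (1 / sqrt (real N))) *
        (exp (- \<i> * complex_of_real a) * exp (\<i> * complex_of_real b))"
      unfolding channel_vec_def codeword_def a_def [symmetric] b_def [symmetric]
      by (simp add: exp_cnj)
    also have "exp (- \<i> * complex_of_real a) * exp (\<i> * complex_of_real b) =
        cnj (exp (- \<i> * complex_of_real (?ph n)))"
      unfolding ph exp_cnj exp_add [symmetric] by (simp add: algebra_simps)
    finally show ?thesis
      unfolding sq .
  qed
  then have "correlation N lam (\<alpha>q, \<beta>q) (\<alpha>s, \<beta>s) =
      cmod (complex_of_real (1 / real N) * cnj (\<Sum>n=1..N. exp (- \<i> * complex_of_real (?ph n))))"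
    unfolding correlation_def cnj_sum sum_distrib_left by simp
  also have "\<dots> = ula_f N (\<alpha>q - \<alpha>s) (\<beta>q - \<beta>s)"
    unfolding norm_mult complex_mod_cnj ula_f_eq_positions [OF assms] by (simp add: norm_divide)
  finally show ?thesis .
qed

end

(* Negating both differences conjugates every summand.  Negating the second alone amounts
   to reversing the array, because the antenna positions are symmetric about its centre. *)

theory Submission
  imports Defs
begin

text \<open>Up to a unimodular factor the sum runs over antenna positions y with a phase whose part
  in the second difference is odd in y and whose part in the first is even
  (\<open>ula_f_eq_positions\<close>). The positions are symmetric about 0, so the substitution y ->
  -y absorbs a sign of the second difference (\<open>ula_f_minus_snd\<close>). Changing both signs
  conjugates the sum (\<open>ula_f_minus_minus\<close>), and these two symmetries generate the
  rest.\<close>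

lemma antenna_pos_rev:
  assumes "n \<le> N + 1"
  shows "antenna_pos N lam (N + 1 - n) = - antenna_pos N lam n"
  using assms by (simp add: antenna_pos_def of_nat_diff field_simps)

lemma ula_f_minus_snd: "ula_f N \<delta>\<^sub>\<alpha> (- \<delta>\<^sub>\<beta>) = ula_f N \<delta>\<^sub>\<alpha> \<delta>\<^sub>\<beta>"
proof -
  \<comment> \<open>\<open>ula_f\<close> does not involve the wavelength, so the value 1 is chosen;
    the divisions by 1 make \<open>?g\<close> match \<open>ula_f_eq_positions\<close>
    literally.\<close>
  let ?g = "\<lambda>b x. exp (- \<i> * complex_of_real (2 * pi / 1 * (b * x - 2 / 1 * \<delta>\<^sub>\<alpha> * x\<^sup>2)))"
  have "(\<Sum>n=1..N. ?g (- \<delta>\<^sub>\<beta>) (antenna_pos N 1 n)) =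
      (\<Sum>n=1..N. ?g (- \<delta>\<^sub>\<beta>) (antenna_pos N 1 (N + 1 - n)))"
    by (rule sum.atLeastAtMost_rev)
  also have "\<dots> = (\<Sum>n=1..N. ?g \<delta>\<^sub>\<beta> (antenna_pos N 1 n))"
    \<comment> \<open>The deletions keep the index in the form \<open>N + 1 - n\<close> that
      \<open>antenna_pos_rev\<close> rewrites.\<close>
    by (rule sum.cong) (simp_all add: antenna_pos_rev del: add_Suc_right One_nat_def)
  finally show ?thesis
    unfolding ula_f_eq_positions [OF zero_less_one] by (rule arg_cong)
qed

text \<open>The phase is linear in the pair of differences, so it changes sign with the pair, and
  conjugation preserves the modulus.\<close>

lemma ula_f_minus_minus: "ula_f N (- \<delta>\<^sub>\<alpha>) (- \<delta>\<^sub>\<beta>) = ula_f N \<delta>\<^sub>\<alpha> \<delta>\<^sub>\<beta>"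
proof -
  have "(\<Sum>n=1..N. exp (- \<i> * complex_of_real
         (pi * (- (- \<delta>\<^sub>\<alpha>) * (real n)\<^sup>2 + (- \<delta>\<^sub>\<beta> + - \<delta>\<^sub>\<alpha> * (real N + 1)) * real n)))) =
      cnj (\<Sum>n=1..N. exp (- \<i> * complex_of_real
         (pi * (- \<delta>\<^sub>\<alpha> * (real n)\<^sup>2 + (\<delta>\<^sub>\<beta> + \<delta>\<^sub>\<alpha> * (real N + 1)) * real n))))"
    unfolding cnj_sum exp_cnj by (rule sum.cong) (simp_all add: algebra_simps)
  then show ?thesis
    unfolding ula_f_def by (simp only: complex_mod_cnj)
qed

lemma ula_f_minus_fst: "ula_f N (- \<delta>\<^sub>\<alpha>) \<delta>\<^sub>\<beta> = ula_f N \<delta>\<^sub>\<alpha> \<delta>\<^sub>\<beta>"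
  using ula_f_minus_snd [of N "- \<delta>\<^sub>\<alpha>" \<delta>\<^sub>\<beta>] ula_f_minus_minus by simp

theorem mainTheorem2:
  fixes N :: nat and lam :: real
  assumes "N \<ge> 1" and "lam > 0"
  shows "(\<forall>\<delta>\<^sub>\<alpha> \<delta>\<^sub>\<beta> :: real.
            ula_f N \<delta>\<^sub>\<alpha> \<delta>\<^sub>\<beta> = ula_f N \<delta>\<^sub>\<alpha> (- \<delta>\<^sub>\<beta>) \<and>
            ula_f N \<delta>\<^sub>\<alpha> (- \<delta>\<^sub>\<beta>) = ula_f N (- \<delta>\<^sub>\<alpha>) \<delta>\<^sub>\<beta> \<and>
            ula_f N (- \<delta>\<^sub>\<alpha>) \<delta>\<^sub>\<beta> = ula_f N (- \<delta>\<^sub>\<alpha>) (- \<delta>\<^sub>\<beta>)) \<and>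
         (\<forall>\<alpha>s \<beta>s \<delta>\<^sub>\<alpha> \<delta>\<^sub>\<beta> :: real.
            correlation N lam (\<alpha>s + \<delta>\<^sub>\<alpha>, \<beta>s + \<delta>\<^sub>\<beta>) (\<alpha>s, \<beta>s) =
              correlation N lam (\<alpha>s + \<delta>\<^sub>\<alpha>, \<beta>s - \<delta>\<^sub>\<beta>) (\<alpha>s, \<beta>s) \<and>
            correlation N lam (\<alpha>s + \<delta>\<^sub>\<alpha>, \<beta>s - \<delta>\<^sub>\<beta>) (\<alpha>s, \<beta>s) =
              correlation N lam (\<alpha>s - \<delta>\<^sub>\<alpha>, \<beta>s + \<delta>\<^sub>\<beta>) (\<alpha>s, \<beta>s) \<and>
            correlation N lam (\<alpha>s - \<delta>\<^sub>\<alpha>, \<beta>s + \<delta>\<^sub>\<beta>) (\<alpha>s, \<beta>s) =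
              correlation N lam (\<alpha>s - \<delta>\<^sub>\<alpha>, \<beta>s - \<delta>\<^sub>\<beta>) (\<alpha>s, \<beta>s))"
  \<comment> \<open>The correlation depends only on coordinate differences, so the reflections about
    the codeword become sign changes in \<open>ula_f\<close>.\<close>
  by (simp add: correlation_eq_ula_f [OF assms(2)] ula_f_minus_fst ula_f_minus_snd)

end
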